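(* Let $W$ be an exact Max-Cut instance on $n\ge2$ vertices with nonnegative weights and no isolated vertices. Then $$o(W)\le n-1.$$ Equality holds if and only if a Hadamard matrix of order $n$ exists and $$W=\lambda A(K_n)\quad\text{for some }\lambda>0.$$
   Context: A weight matrix $W\in\mathbb R^{n\times n}$ is symmetric with zero diagonal and nonnegative entries; its support graph on $\{1,\dots,n\}$ has edges $\{i,j\}$ with $W_{ij}>0$. Put $\operatorname{MC}(W)=\max_{x\in\{-1,1\}^n}\frac14\sum_{i\ne j}W_{ij}(1-x_ix_j)$ and $\operatorname{SDP}(W)=\max\{\frac14\sum_{i\ne j}W_{ij}(1-X_{ij}):X\succeq0,\ X_{ii}=1\ \forall i\}$. The instance is exact if $\operatorname{MC}(W)=\operatorname{SDP}(W)$. Let $\mathcal C(W)$ be the set of $x\in\{-1,1\}^n$ attaining $\operatorname{MC}(W)$; the orthogonality number $o(W)$ is the maximum size of a pairwise orthogonal subset of $\mathcal C(W)$. $A(K_n)$ is the adjacency matrix of the complete graph on $n$ vertices. A Hadamard matrix of order $n$ is $H\in\{-1,1\}^{n\times n}$ with $HH^\top=nI$. *)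

theory Defs
  imports "HOL-Analysis.Analysis"
begin

text \<open>
  The vertex set \<open>{1, \<dots>, n}\<close> is a finite index type \<open>'n\<close>, so \<open>n = CARD('n)\<close>.
\<close>

definition weight_matrix :: "real^'n^'n \<Rightarrow> bool" where
  "weight_matrix W \<longleftrightarrow>
     transpose W = W \<and> (\<forall>i. W $ i $ i = 0) \<and> (\<forall>i j. 0 \<le> W $ i $ j)"

definition support_edges :: "real^'n^'n \<Rightarrow> 'n set set" where
  "support_edges W = {{i, j} |i j. 0 < W $ i $ j}"

definition isolated_vertex :: "real^'n^'n \<Rightarrow> 'n \<Rightarrow> bool" where
  "isolated_vertex W i \<longleftrightarrow> (\<forall>e \<in> support_edges W. i \<notin> e)"

definition sign_vectors :: "(real^'n) set" where
  "sign_vectors = {x. \<forall>i. x $ i \<in> {-1, 1}}"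

text \<open>
  Sums over \<open>i \<noteq> j\<close> range over ordered pairs, so every edge is counted twice; with the
  factor \<open>1/4\<close> each cut edge contributes exactly its weight.
\<close>

definition cut_value :: "real^'n^'n \<Rightarrow> real^'n \<Rightarrow> real" where
  "cut_value W x = 1/4 * (\<Sum>(i, j) \<in> {(i, j). i \<noteq> j}. W $ i $ j * (1 - x $ i * x $ j))"

definition MC :: "real^'n^'n \<Rightarrow> real" where
  "MC W = Max (cut_value W ` sign_vectors)"

definition psd :: "real^'n^'n \<Rightarrow> bool" where
  "psd X \<longleftrightarrow> transpose X = X \<and> (\<forall>v. 0 \<le> v \<bullet> (X *v v))"

definition sdp_feasible :: "(real^'n^'n) set" where
  "sdp_feasible = {X. psd X \<and> (\<forall>i. X $ i $ i = 1)}"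

definition sdp_value :: "real^'n^'n \<Rightarrow> real^'n^'n \<Rightarrow> real" where
  "sdp_value W X = 1/4 * (\<Sum>(i, j) \<in> {(i, j). i \<noteq> j}. W $ i $ j * (1 - X $ i $ j))"

text \<open>The supremum is a maximum; see \<open>SDP_attained\<close> below.\<close>

definition SDP :: "real^'n^'n \<Rightarrow> real" where
  "SDP W = Sup (sdp_value W ` sdp_feasible)"

definition exact_instance :: "real^'n^'n \<Rightarrow> bool" where
  "exact_instance W \<longleftrightarrow> MC W = SDP W"

definition max_cuts :: "real^'n^'n \<Rightarrow> (real^'n) set" where
  "max_cuts W = {x \<in> sign_vectors. cut_value W x = MC W}"

definition orthogonality_number :: "real^'n^'n \<Rightarrow> nat" where
  "orthogonality_number W = Max {card S |S. S \<subseteq> max_cuts W \<and> pairwise orthogonal S}"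

definition adj_complete :: "real^'n^'n" where
  "adj_complete = (\<chi> i j. if i = j then 0 else 1)"

definition hadamard_matrix :: "real^'n^'n \<Rightarrow> bool" where
  "hadamard_matrix H \<longleftrightarrow>
     (\<forall>i j. H $ i $ j \<in> {-1, 1}) \<and> H ** transpose H = mat (real CARD('n))"

text \<open>
  The maxima in \<open>MC\<close>, \<open>SDP\<close> and \<open>orthogonality_number\<close> are over nonempty sets and are attained.
\<close>

lemma finite_sign_vectors: "finite (sign_vectors :: (real^'n) set)"
proof -
  have "sign_vectors \<subseteq> (\<lambda>f. \<chi> i. f i) ` (PiE (UNIV :: 'n set) (\<lambda>_. {-1, 1 :: real}))"
  proof
    fix x :: "real^'n" assume "x \<in> sign_vectors"
    then have "(\<lambda>i. x $ i) \<in> PiE UNIV (\<lambda>_. {-1, 1})"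
      by (auto simp: sign_vectors_def)
    moreover have "x = (\<chi> i. x $ i)" by simp
    ultimately show "x \<in> (\<lambda>f. \<chi> i. f i) ` (PiE (UNIV :: 'n set) (\<lambda>_. {-1, 1 :: real}))"
      by blast
  qed
  moreover have "finite (PiE (UNIV :: 'n set) (\<lambda>_. {-1, 1 :: real}))"
    by (intro finite_PiE) auto
  ultimately show ?thesis by (meson finite_imageI finite_subset)
qed

lemma MC_attained: "max_cuts W \<noteq> {}"
proof -
  have "(\<chi> i. 1) \<in> sign_vectors" by (simp add: sign_vectors_def)
  then have "Max (cut_value W ` sign_vectors) \<in> cut_value W ` sign_vectors"
    using finite_sign_vectors by (intro Max_in) auto
  then show ?thesis by (auto simp: max_cuts_def MC_def)
qed

lemma orthogonality_number_attained:
  "\<exists>S. S \<subseteq> max_cuts W \<and> pairwise orthogonal S \<and> card S = orthogonality_number W"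
proof -
  let ?A = "{card S |S. S \<subseteq> max_cuts W \<and> pairwise orthogonal S}"
  have "finite (max_cuts W)"
    unfolding max_cuts_def by (rule finite_subset[OF _ finite_sign_vectors]) blast
  then have "finite ?A"
    by (intro finite_subset[of ?A "card ` Pow (max_cuts W)"]) auto
  moreover have "card {} \<in> ?A"
    by (intro CollectI exI[of _ "{}"]) auto
  ultimately have "Max ?A \<in> ?A" by (intro Max_in) auto
  then show ?thesis by (auto simp: orthogonality_number_def)
qed

lemma sdp_feasible_entry:
  fixes X :: "real^'n^'n"
  assumes "X \<in> sdp_feasible"
  shows "\<bar>X $ i $ j\<bar> \<le> 1"
proof (cases "i = j")
  case True
  then show ?thesis using assms by (simp add: sdp_feasible_def)
next
  case False
  have sym: "X $ j $ i = X $ i $ j" and diag: "X $ i $ i = 1" "X $ j $ j = 1"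
    using assms by (auto simp: sdp_feasible_def psd_def transpose_def vec_eq_iff)
  have mv: "X *v axis k 1 = column k X" for k
    by (simp add: matrix_vector_mult_basis)
  have "0 \<le> (axis i 1 + axis j s) \<bullet> (X *v (axis i 1 + axis j s))" for s
    using assms by (simp add: sdp_feasible_def psd_def)
  moreover have "(axis i 1 + axis j s) \<bullet> (X *v (axis i 1 + axis j s))
      = 1 + 2 * s * X $ i $ j + s * s" for s :: real
  proof -
    have "axis j s = s *\<^sub>R (axis j 1 :: real^'n)"
      by (simp add: vec_eq_iff axis_def)
    then have "X *v (axis i 1 + axis j s) = column i X + s *\<^sub>R column j X"
      by (simp add: matrix_vector_right_distrib matrix_vector_mult_scaleR mv)
    then show ?thesis
      by (simp add: inner_add_left inner_axis' column_def sym diag algebra_simps)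
  qed
  ultimately have "0 \<le> 1 + 2 * s * X $ i $ j + s * s" for s :: real
    by simp
  from this[of 1] this[of "-1"] show ?thesis by simp
qed

lemma SDP_attained:
  fixes W :: "real^'n^'n"
  shows "\<exists>X \<in> sdp_feasible. sdp_value W X = SDP W \<and> (\<forall>Y \<in> sdp_feasible. sdp_value W Y \<le> SDP W)"
proof -
  have "mat 1 \<in> (sdp_feasible :: (real^'n^'n) set)"
    by (auto simp: sdp_feasible_def psd_def transpose_mat matrix_vector_mul_lid) (simp add: mat_def)
  then have ne: "(sdp_feasible :: (real^'n^'n) set) \<noteq> {}" by blast
  have bdd: "bounded (sdp_feasible :: (real^'n^'n) set)"
  proof (rule boundedI)
    fix X :: "real^'n^'n" assume X: "X \<in> sdp_feasible"
    have "norm X \<le> (\<Sum>i\<in>UNIV. norm (X $ i))"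
      unfolding norm_vec_def by (rule L2_set_le_sum) simp
    also have "\<dots> \<le> (\<Sum>i\<in>UNIV. \<Sum>j\<in>UNIV. \<bar>X $ i $ j\<bar>)"
      by (intro sum_mono order_trans[OF norm_le_l1_cart]) simp
    also have "\<dots> \<le> (\<Sum>i\<in>(UNIV :: 'n set). \<Sum>j\<in>(UNIV :: 'n set). 1)"
      by (intro sum_mono sdp_feasible_entry X)
    finally show "norm X \<le> (\<Sum>i\<in>(UNIV :: 'n set). \<Sum>j\<in>(UNIV :: 'n set). 1)" .
  qed
  have psd_eq: "psd X \<longleftrightarrow> (\<forall>i j. X $ j $ i = X $ i $ j) \<and>
      (\<forall>v. 0 \<le> (\<Sum>i\<in>UNIV. v $ i * (\<Sum>j\<in>UNIV. X $ i $ j * v $ j)))" for X :: "real^'n^'n"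
    unfolding psd_def by (simp only: vec_eq_iff transpose_def vec_lambda_beta inner_vec_def
        matrix_vector_mult_def inner_real_def)
  have eq: "(sdp_feasible :: (real^'n^'n) set) =
      (\<Inter>i j. {X. X $ j $ i = X $ i $ j}) \<inter> (\<Inter>v. {X. 0 \<le> (\<Sum>i\<in>UNIV. v $ i * (\<Sum>j\<in>UNIV. X $ i $ j * v $ j))})
        \<inter> (\<Inter>i. {X. X $ i $ i = 1})"
    unfolding sdp_feasible_def psd_eq by blast
  have "closed (sdp_feasible :: (real^'n^'n) set)"
    unfolding eq
    by (intro closed_Int closed_INT ballI closed_Collect_eq closed_Collect_le continuous_intros)
  with bdd have "compact (sdp_feasible :: (real^'n^'n) set)"
    by (simp add: compact_eq_bounded_closed)
  moreover have "continuous_on sdp_feasible (sdp_value W)"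
    unfolding sdp_value_def case_prod_unfold by (intro continuous_intros)
  ultimately obtain X where X: "X \<in> sdp_feasible"
    "\<forall>Y \<in> sdp_feasible. sdp_value W Y \<le> sdp_value W X"
    using continuous_attains_sup[OF _ ne] by blast
  then have "SDP W = sdp_value W X"
    unfolding SDP_def by (intro cSup_eq_maximum) auto
  with X show ?thesis by auto
qed

end

theory Submission
  imports Defs
begin

text \<open>
  Complementary slackness drives the proof. For a maximum cut \<open>x\<close> of an exact instance, the
  rank-one matrix \<open>x x\<^sup>T\<close> is an optimal solution of the semidefinite relaxation, and the
  corresponding dual slack matrix is \<open>M = W + Diag d\<close> with \<open>d\<^sub>i = - x\<^sub>i (W x)\<^sub>i\<close>. It is positive
  semidefinite (\<open>slack_quadratic_nonneg\<close>), and its quadratic form vanishes on every maximum cut \<open>y\<close>,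
  so \<open>M y = 0\<close> (\<open>slack_mult_max_cut\<close>): every row of \<open>M\<close> is orthogonal to all maximum cuts at once.
  As no vertex is isolated, all rows of \<open>M\<close> are nonzero, and pairwise orthogonal maximum
  cuts \<open>S\<close> therefore number at most \<open>n - 1\<close>.

  If there are exactly \<open>n - 1\<close> of them, a row \<open>r\<close> of \<open>M\<close> completes \<open>S\<close> to an orthogonal basis.
  Parseval's identity for a standard basis vector reads \<open>1 = (n - 1)/n + r\<^sub>j\<^sup>2/|r|\<^sup>2\<close>, because each
  member of \<open>S\<close> has entries \<open>\<plusminus>1\<close> and squared norm \<open>n\<close>. Thus all entries of \<open>r\<close> have the same
  absolute value (\<open>orthogonal_complement_of_signs\<close>); they are nonnegative, so \<open>r\<close> is a positive
  multiple of the all-ones vector. By symmetry of \<open>M\<close> the multiple is the same for all rows, which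
  says that \<open>W\<close> is a multiple of \<open>A(K\<^sub>n)\<close>, while \<open>S\<close> together with the all-ones vector forms the
  rows of a Hadamard matrix.

  Conversely, flipping signs of columns turns some row of a Hadamard matrix into the all-ones vector.
  The other \<open>n - 1\<close> rows are then balanced, and balanced sign vectors are the maximum
  cuts of a complete graph with equal weights.
\<close>

section \<open>Orthogonal families in Euclidean space\<close>

lemma card_orthogonal_le:
  fixes S :: "(real^'n) set"
  assumes "pairwise orthogonal S" "0 \<notin> S"
  shows "finite S" "card S \<le> CARD('n)"
  using independent_bound[OF pairwise_orthogonal_independent[OF assms]] by auto

lemma span_orthogonal_full:
  fixes S :: "(real^'n) set"
  assumes "pairwise orthogonal S" "0 \<notin> S" "card S = CARD('n)"
  shows "span S = UNIV"
proof -
  have "independent S" using pairwise_orthogonal_independent assms by blast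
  then show ?thesis
    using card_ge_dim_independent[of S UNIV] assms(3) by (auto simp: dim_UNIV)
qed

lemma parseval_orthogonal_basis:
  fixes B :: "(real^'n) set"
  assumes "pairwise orthogonal B" "0 \<notin> B" "card B = CARD('n)"
  shows "(\<Sum>b\<in>B. (b $ j)\<^sup>2 / (b \<bullet> b)) = 1"
proof -
  let ?e = "axis j 1 :: real^'n"
  let ?r = "?e - (\<Sum>b\<in>B. (b \<bullet> ?e / (b \<bullet> b)) *\<^sub>R b)"
  have "orthogonal ?r ?r"
    using span_orthogonal_full[OF assms] by (intro Gram_Schmidt_step[OF assms(1)]) auto
  then have "?e = (\<Sum>b\<in>B. (b \<bullet> ?e / (b \<bullet> b)) *\<^sub>R b)"
    by (simp add: orthogonal_self)
  then have "?e $ j = (\<Sum>b\<in>B. (b \<bullet> ?e / (b \<bullet> b)) *\<^sub>R b) $ j"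
    by simp
  then show ?thesis
    by (simp add: inner_axis power2_eq_square)
qed

lemma sign_vector_square: "x \<in> sign_vectors \<Longrightarrow> x $ i * x $ i = 1"
proof -
  assume "x \<in> sign_vectors"
  then have "x $ i \<in> {-1, 1}" by (simp add: sign_vectors_def)
  then show ?thesis by auto
qed

lemma inner_sign_vector_self:
  fixes x :: "real^'n"
  assumes "x \<in> sign_vectors"
  shows "x \<bullet> x = CARD('n)"
  using assms by (simp add: inner_vec_def sign_vector_square)

lemma zero_not_sign_vector: "0 \<notin> (sign_vectors :: (real^'n) set)"
  by (simp add: sign_vectors_def)

text \<open>
  Each sign vector contributes \<open>1/n\<close> to Parseval's identity for every coordinate, so what is left for
  the last vector of an orthogonal basis is also \<open>1/n\<close> for every coordinate.
\<close>

lemma orthogonal_complement_of_signs: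
  fixes S :: "(real^'n) set"
  assumes S: "S \<subseteq> sign_vectors" "pairwise orthogonal S" "card S = CARD('n) - 1"
    and r: "r \<noteq> 0" "\<And>s. s \<in> S \<Longrightarrow> orthogonal r s"
  shows "CARD('n) * (r $ j)\<^sup>2 = r \<bullet> r"
proof -
  let ?n = "real CARD('n)"
  have n: "CARD('n) > 0" by simp
  have 0: "0 \<notin> S" using S(1) zero_not_sign_vector by blast
  have fin: "finite S" using card_orthogonal_le[OF S(2) 0] by blast
  have rS: "r \<notin> S" using r orthogonal_self by blast
  have "card (insert r S) = CARD('n)" using fin rS S(3) n by simp
  moreover have "pairwise orthogonal (insert r S)"
    using S(2) r(2) by (auto simp: pairwise_insert orthogonal_commute)
  ultimately have "(\<Sum>b\<in>insert r S. (b $ j)\<^sup>2 / (b \<bullet> b)) = 1"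
    using 0 r(1) by (intro parseval_orthogonal_basis) auto
  moreover have "(\<Sum>b\<in>S. (b $ j)\<^sup>2 / (b \<bullet> b)) = (\<Sum>b\<in>S. 1 / ?n)"
  proof (rule sum.cong)
    fix b assume "b \<in> S"
    then have "b \<in> sign_vectors" using S(1) by blast
    then show "(b $ j)\<^sup>2 / (b \<bullet> b) = 1 / ?n"
      unfolding inner_sign_vector_self[OF \<open>b \<in> sign_vectors\<close>]
      using sign_vector_square[OF \<open>b \<in> sign_vectors\<close>] by (simp add: power2_eq_square)
  qed simp
  ultimately have "(r $ j)\<^sup>2 / (r \<bullet> r) + (?n - 1) / ?n = 1"
    using fin rS S(3) n by (simp add: of_nat_diff)
  then show ?thesis using r(1) by (simp add: field_simps)
qed

section \<open>The dual slack matrix\<close>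

lemma sum_off_diagonal:
  fixes f :: "'n::finite \<Rightarrow> 'n \<Rightarrow> real"
  assumes "\<And>i. f i i = 0"
  shows "(\<Sum>(i, j)\<in>{(i, j). i \<noteq> j}. f i j) = (\<Sum>i\<in>UNIV. \<Sum>j\<in>UNIV. f i j)"
proof -
  have "(\<Sum>(i, j)\<in>{(i, j). i \<noteq> j}. f i j) = (\<Sum>(i, j)\<in>UNIV. f i j)"
    using assms by (intro sum.mono_neutral_left) auto
  then show ?thesis by (simp add: sum.cartesian_product)
qed

lemma sdp_value_eq:
  assumes "weight_matrix W"
  shows "sdp_value W X =
    1/4 * ((\<Sum>i\<in>UNIV. \<Sum>j\<in>UNIV. W $ i $ j) - (\<Sum>i\<in>UNIV. \<Sum>j\<in>UNIV. W $ i $ j * X $ i $ j))"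
  using assms unfolding sdp_value_def
  by (subst sum_off_diagonal) (auto simp: weight_matrix_def algebra_simps sum_subtractf)

lemma inner_matrix_vector:
  fixes A :: "real^'n^'n"
  shows "v \<bullet> (A *v w) = (\<Sum>i\<in>UNIV. \<Sum>j\<in>UNIV. A $ i $ j * (v $ i * w $ j))"
  by (simp add: inner_vec_def matrix_vector_mult_def sum_distrib_left mult_ac)

lemma cut_value_eq:
  assumes "weight_matrix W"
  shows "cut_value W x = 1/4 * ((\<Sum>i\<in>UNIV. \<Sum>j\<in>UNIV. W $ i $ j) - x \<bullet> (W *v x))"
  using assms unfolding cut_value_def inner_matrix_vector
  by (subst sum_off_diagonal) (auto simp: weight_matrix_def algebra_simps sum_subtractf)

lemma exact_max_cut_optimal:
  assumes "weight_matrix W" "exact_instance W" "x \<in> max_cuts W" "X \<in> sdp_feasible"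
  shows "x \<bullet> (W *v x) \<le> (\<Sum>i\<in>UNIV. \<Sum>j\<in>UNIV. W $ i $ j * X $ i $ j)"
proof -
  have "sdp_value W X \<le> SDP W" using SDP_attained[of W] assms(4) by blast
  also have "\<dots> = cut_value W x" using assms by (simp add: exact_instance_def max_cuts_def)
  finally show ?thesis by (simp add: sdp_value_eq cut_value_eq assms(1))
qed

definition slack_matrix :: "real^'n^'n \<Rightarrow> real^'n \<Rightarrow> real^'n^'n" where
  "slack_matrix W x = (\<chi> i j. W $ i $ j - (if i = j then x $ i * (W *v x) $ i else 0))"

lemma slack_quadratic:
  "v \<bullet> (slack_matrix W x *v v) = v \<bullet> (W *v v) - (\<Sum>i\<in>UNIV. x $ i * (W *v x) $ i * (v $ i)\<^sup>2)"
proof -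
  have "(\<Sum>j\<in>UNIV. slack_matrix W x $ i $ j * (v $ i * v $ j))
      = (\<Sum>j\<in>UNIV. W $ i $ j * (v $ i * v $ j)) - x $ i * (W *v x) $ i * (v $ i)\<^sup>2" for i
  proof -
    have "slack_matrix W x $ i $ j * (v $ i * v $ j) = W $ i $ j * (v $ i * v $ j)
        - (if j = i then x $ i * (W *v x) $ i * (v $ i)\<^sup>2 else 0)" for j
      by (simp add: slack_matrix_def algebra_simps power2_eq_square)
    then show ?thesis by (simp add: sum_subtractf)
  qed
  then show ?thesis by (simp add: inner_matrix_vector sum_subtractf)
qed

text \<open>
  The Gram matrix of the vectors \<open>(x\<^sub>i, \<surd>s w\<^sub>i)\<close>, normalised to unit length: a curve of feasible
  solutions that starts at \<open>x x\<^sup>T\<close> for \<open>s = 0\<close>.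
\<close>

lemma normalised_gram_feasible:
  fixes x w :: "real^'n"
  assumes x: "x \<in> sign_vectors" and s: "0 \<le> s"
  defines "g \<equiv> \<lambda>i. 1 / sqrt (1 + s * (w $ i)\<^sup>2)"
  shows "(\<chi> i j. (x $ i * x $ j + s * (w $ i * w $ j)) * (g i * g j)) \<in> sdp_feasible"
    (is "?X \<in> _")
proof -
  have "transpose ?X = ?X" by (simp add: transpose_def vec_eq_iff mult_ac)
  moreover have "0 \<le> v \<bullet> (?X *v v)" for v
  proof -
    have "v \<bullet> (?X *v v) = (\<Sum>i\<in>UNIV. v $ i * g i * x $ i)\<^sup>2 + s * (\<Sum>i\<in>UNIV. v $ i * g i * w $ i)\<^sup>2"
      by (simp add: inner_matrix_vector power2_eq_square sum_product sum_distrib_left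
          sum.distrib[symmetric] algebra_simps)
    then show ?thesis using s by simp
  qed
  moreover have "?X $ i $ i = 1" for i
  proof -
    have "1 + s * (w $ i)\<^sup>2 > 0" using s by (simp add: add_pos_nonneg)
    moreover have "x $ i * x $ i = 1" using x by (rule sign_vector_square)
    ultimately show ?thesis
      by (simp add: g_def power2_eq_square flip: real_sqrt_mult)
  qed
  ultimately show ?thesis by (simp add: sdp_feasible_def psd_def)
qed

text \<open>
  By exactness \<open>\<Sum>i j. W\<^sub>i\<^sub>j X\<^sub>i\<^sub>j\<close> is minimal at \<open>s = 0\<close> along the curve above, and its one-sided
  derivative there is the quadratic form of the slack matrix at \<open>w\<close>.
\<close>

lemma slack_quadratic_nonneg:
  fixes W :: "real^'n^'n"
  assumes W: "weight_matrix W" "exact_instance W" and x: "x \<in> max_cuts W"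
  shows "0 \<le> w \<bullet> (slack_matrix W x *v w)"
proof -
  define g where "g i s = 1 / sqrt (1 + s * (w $ i)\<^sup>2)" for i s
  define f where "f s = (\<Sum>i\<in>UNIV. \<Sum>j\<in>UNIV.
    W $ i $ j * ((x $ i * x $ j + s * (w $ i * w $ j)) * (g i s * g j s)))" for s
  define D where "D = (\<Sum>i\<in>UNIV. \<Sum>j\<in>UNIV.
    W $ i $ j * (w $ i * w $ j - x $ i * x $ j * ((w $ i)\<^sup>2 + (w $ j)\<^sup>2) / 2))"
  have sgn: "x \<in> sign_vectors" using x by (simp add: max_cuts_def)
  have f0: "f 0 = x \<bullet> (W *v x)" by (simp add: f_def g_def inner_matrix_vector)
  have min: "f 0 \<le> f s" if "0 \<le> s" for s
    using exact_max_cut_optimal[OF W x normalised_gram_feasible[OF sgn that, of w]]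
    by (simp add: f0) (simp add: f_def g_def)
  have g: "(g i has_real_derivative - (w $ i)\<^sup>2 / 2) (at 0)" for i
    unfolding g_def by (auto intro!: derivative_eq_intros simp: field_simps)
  have g0: "g i 0 = 1" for i by (simp add: g_def)
  have "(f has_real_derivative D) (at 0)"
    unfolding f_def D_def
    by (auto intro!: derivative_eq_intros g sum.cong simp: g0 algebra_simps add_divide_distrib)
  then have "0 \<le> D"
    using DERIV_neg_dec_right[of f D 0] min
    by (metis add.left_neutral dense less_eq_real_def linorder_not_less)
  moreover have "D = w \<bullet> (slack_matrix W x *v w)"
  proof -
    let ?h = "\<lambda>i j. W $ i $ j * (x $ i * x $ j) * (w $ i)\<^sup>2"
    have sym: "W $ j $ i = W $ i $ j" for i j
      using W(1) by (auto simp: weight_matrix_def transpose_def vec_eq_iff)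
    have "(\<Sum>i\<in>UNIV. \<Sum>j\<in>UNIV. ?h j i) = (\<Sum>i\<in>UNIV. \<Sum>j\<in>UNIV. ?h i j)"
      by (rule sum.swap)
    moreover have "D = w \<bullet> (W *v w)
        - ((\<Sum>i\<in>UNIV. \<Sum>j\<in>UNIV. ?h i j) + (\<Sum>i\<in>UNIV. \<Sum>j\<in>UNIV. ?h j i)) / 2"
      unfolding D_def inner_matrix_vector
      by (simp add: sym sum_subtractf[symmetric] sum.distrib[symmetric] sum_divide_distrib
          field_simps)
    moreover have "(\<Sum>i\<in>UNIV. \<Sum>j\<in>UNIV. ?h i j) = (\<Sum>i\<in>UNIV. x $ i * (W *v x) $ i * (w $ i)\<^sup>2)"
      by (simp add: matrix_vector_mult_def sum_distrib_left sum_distrib_right mult_ac)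
    ultimately show ?thesis by (simp add: slack_quadratic)
  qed
  ultimately show ?thesis by simp
qed

lemma transpose_slack:
  assumes "weight_matrix W"
  shows "transpose (slack_matrix W x) = slack_matrix W x"
  using assms by (auto simp: weight_matrix_def slack_matrix_def transpose_def vec_eq_iff)

lemma psd_isotropic_in_kernel:
  fixes M :: "real^'n^'n"
  assumes M: "psd M" and y: "y \<bullet> (M *v y) = 0"
  shows "M *v y = 0"
proof (rule ccontr)
  assume "M *v y \<noteq> 0"
  define v where "v = M *v y"
  define k where "k = v \<bullet> (M *v v)"
  have c: "v \<bullet> v > 0" using \<open>M *v y \<noteq> 0\<close> by (simp add: v_def)
  have k: "k \<ge> 0" using M by (simp add: psd_def k_def)
  have "y \<bullet> (M *v v) = v \<bullet> v"
    using M by (metis dot_lmul_matrix psd_def transpose_matrix_vector v_def)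
  then have "(y + t *\<^sub>R v) \<bullet> (M *v (y + t *\<^sub>R v)) = t * (2 * (v \<bullet> v) + t * k)" for t
    using y by (simp add: matrix_vector_right_distrib matrix_vector_mult_scaleR inner_add_left
        inner_add_right k_def flip: v_def) (simp add: algebra_simps)
  then have nonneg: "0 \<le> t * (2 * (v \<bullet> v) + t * k)" for t
    using M by (metis psd_def)
  \<comment> \<open>a step this short keeps the second factor positive, while \<open>t\<close> is negative\<close>
  define t where "t = - (v \<bullet> v) / (k + 1)"
  have "t < 0" using c k by (simp add: t_def divide_neg_pos)
  moreover have "2 * (v \<bullet> v) + t * k > 0"
  proof -
    have "(v \<bullet> v) * k \<le> (v \<bullet> v) * (k + 1)" using c by simp
    then have "(v \<bullet> v) * k / (k + 1) \<le> v \<bullet> v" using k by (simp add: divide_le_eq)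
    then have "v \<bullet> v * k / (k + 1) < 2 * (v \<bullet> v)" using c by linarith
    then show ?thesis by (simp add: t_def)
  qed
  ultimately show False using nonneg[of t] by (simp add: mult_less_0_iff not_less[symmetric])
qed

text \<open>
  The diagonal shift contributes the same amount to the quadratic form at every sign vector; hence the
  form vanishes at all maximum cuts simultaneously, not only at the \<open>x\<close> defining the slack matrix.
\<close>

lemma slack_mult_max_cut:
  assumes W: "weight_matrix W" "exact_instance W" and x: "x \<in> max_cuts W" and y: "y \<in> max_cuts W"
  shows "slack_matrix W x *v y = 0"
proof (rule psd_isotropic_in_kernel)
  show "psd (slack_matrix W x)"
    using slack_quadratic_nonneg[OF W x] transpose_slack[OF W(1)] by (simp add: psd_def)
  have "cut_value W x = cut_value W y" using x y by (simp add: max_cuts_def)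
  then have "x \<bullet> (W *v x) = y \<bullet> (W *v y)" by (simp add: cut_value_eq W(1))
  moreover have "(y $ i)\<^sup>2 = 1" for i
    using y by (simp add: max_cuts_def sign_vector_square power2_eq_square)
  ultimately show "y \<bullet> (slack_matrix W x *v y) = 0"
    unfolding slack_quadratic by (simp add: inner_vec_def)
qed

lemma slack_nonneg:
  assumes W: "weight_matrix W" "exact_instance W" and x: "x \<in> max_cuts W"
  shows "0 \<le> slack_matrix W x $ i $ j"
proof (cases "i = j")
  case True
  have "axis i 1 \<bullet> (slack_matrix W x *v axis i 1) = slack_matrix W x $ i $ i"
    by (simp add: matrix_vector_mult_basis inner_axis' column_def)
  then show ?thesis using True slack_quadratic_nonneg[OF W x, of "axis i 1"] by simp
next
  case False
  then show ?thesis using W(1) by (simp add: slack_matrix_def weight_matrix_def)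
qed

lemma slack_row_nonzero:
  assumes "weight_matrix W" "\<not> isolated_vertex W i"
  shows "slack_matrix W x $ i \<noteq> 0"
proof -
  have sym: "W $ b $ a = W $ a $ b" for a b
    using assms(1) by (auto simp: weight_matrix_def transpose_def vec_eq_iff)
  obtain j where j: "0 < W $ i $ j"
    using assms(2) sym by (auto simp: isolated_vertex_def support_edges_def) metis
  then have "i \<noteq> j" using assms(1) by (auto simp: weight_matrix_def)
  then have "slack_matrix W x $ i $ j > 0" using j by (simp add: slack_matrix_def)
  then show ?thesis by auto
qed

lemma slack_row_orthogonal:
  assumes "weight_matrix W" "exact_instance W" "x \<in> max_cuts W" "y \<in> max_cuts W"
  shows "orthogonal (slack_matrix W x $ i) y"
proof -
  have "(slack_matrix W x *v y) $ i = 0" using slack_mult_max_cut[OF assms] by simp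
  then show ?thesis by (simp add: matrix_vector_mul_component orthogonal_def)
qed

section \<open>The bound and the equality case\<close>

lemma card_orthogonal_max_cuts_less:
  fixes W :: "real^'n^'n"
  assumes W: "weight_matrix W" "exact_instance W" "\<forall>i. \<not> isolated_vertex W i"
    and S: "S \<subseteq> max_cuts W" "pairwise orthogonal S"
  shows "card S < CARD('n)"
proof -
  obtain x where x: "x \<in> max_cuts W" using MC_attained[of W] by blast
  define r where "r = slack_matrix W x $ undefined"
  have r: "r \<noteq> 0" using slack_row_nonzero W by (auto simp: r_def)
  have rS: "orthogonal r s" if "s \<in> S" for s
    using slack_row_orthogonal[OF W(1,2) x] that S(1) by (auto simp: r_def)
  have "S \<subseteq> sign_vectors" using S(1) by (auto simp: max_cuts_def)
  then have 0: "0 \<notin> S" using zero_not_sign_vector by blast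
  have "r \<notin> S" using r rS orthogonal_self by blast
  moreover have "pairwise orthogonal (insert r S)"
    using S(2) rS by (auto simp: pairwise_insert orthogonal_commute)
  ultimately show ?thesis
    using card_orthogonal_le[of "insert r S"] 0 r card_orthogonal_le(1)[OF S(2) 0] by auto
qed

lemma hadamard_of_orthogonal_signs:
  fixes B :: "(real^'n) set"
  assumes B: "B \<subseteq> sign_vectors" "pairwise orthogonal B" "card B = CARD('n)"
  shows "\<exists>H :: real^'n^'n. hadamard_matrix H"
proof -
  have "finite B" using B(3) by (simp add: card_ge_0_finite)
  then obtain f :: "'n \<Rightarrow> real^'n" where f: "bij_betw f UNIV B"
    using finite_same_card_bij[of "UNIV :: 'n set" B] B(3) by auto
  have fs: "f i \<in> sign_vectors" for i using f B(1) by (auto simp: bij_betw_def)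
  have "f i \<bullet> f j = (if i = j then real CARD('n) else 0)" for i j
  proof (cases "i = j")
    case False
    then have "f i \<noteq> f j" using f by (auto simp: bij_betw_def inj_on_def)
    then have "orthogonal (f i) (f j)" using f B(2) by (auto simp: bij_betw_def pairwise_def)
    then show ?thesis using False by (simp add: orthogonal_def)
  qed (simp add: inner_sign_vector_self[OF fs])
  then have "(\<chi> i. f i) ** transpose (\<chi> i. f i) = mat (real CARD('n))"
    by (simp add: vec_eq_iff matrix_matrix_mult_def transpose_def mat_def inner_vec_def)
  moreover have "(\<chi> i. f i) $ i $ j \<in> {-1, 1}" for i j
    using fs[of i] by (simp add: sign_vectors_def)
  ultimately show ?thesis unfolding hadamard_matrix_def by blast
qed

lemma extremal_orthogonal_max_cuts:
  fixes W :: "real^'n^'n"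
  assumes W: "weight_matrix W" "exact_instance W" "\<forall>i. \<not> isolated_vertex W i"
    and S: "S \<subseteq> max_cuts W" "pairwise orthogonal S" "card S = CARD('n) - 1"
  shows "\<exists>H :: real^'n^'n. hadamard_matrix H" "\<exists>c>0. W = c *\<^sub>R adj_complete"
proof -
  obtain x where x: "x \<in> max_cuts W" using MC_attained[of W] by blast
  let ?M = "slack_matrix W x"
  let ?one = "(\<chi> j. 1) :: real^'n"
  have sgn: "S \<subseteq> sign_vectors" using S(1) by (auto simp: max_cuts_def)
  have rS: "orthogonal (?M $ i) s" if "s \<in> S" for i s
    using slack_row_orthogonal[OF W(1,2) x] that S(1) by blast
  have r0: "?M $ i \<noteq> 0" for i using slack_row_nonzero W by blast
  have row: "?M $ i $ j = ?M $ i $ k" for i j k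
  proof -
    have "CARD('n) * (?M $ i $ j)\<^sup>2 = CARD('n) * (?M $ i $ k)\<^sup>2"
      using orthogonal_complement_of_signs[OF sgn S(2,3) r0 rS] by simp
    then show ?thesis using slack_nonneg[OF W(1,2) x] by (simp add: power2_eq_iff_nonneg)
  qed
  have sym: "?M $ i $ j = ?M $ j $ i" for i j
    using transpose_slack[OF W(1), of x] by (auto simp: transpose_def vec_eq_iff)
  define c where "c = ?M $ undefined $ undefined"
  have Mc: "?M $ i $ j = c" for i j unfolding c_def using row sym by metis
  have row_eq: "?M $ i = c *\<^sub>R ?one" for i by (simp add: vec_eq_iff Mc)
  have "c \<ge> 0" unfolding c_def by (rule slack_nonneg[OF W(1,2) x])
  moreover have "c \<noteq> 0" using r0 by (auto simp: row_eq)
  ultimately have c: "c > 0" by simp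
  have "W $ i $ j = c" if "i \<noteq> j" for i j using Mc[of i j] that by (simp add: slack_matrix_def)
  then have "W = c *\<^sub>R adj_complete"
    using W(1) by (auto simp: vec_eq_iff adj_complete_def weight_matrix_def)
  with c show "\<exists>c>0. W = c *\<^sub>R adj_complete" by blast
  have oneS: "orthogonal ?one s" if "s \<in> S" for s
    using rS[OF that] c by (simp add: row_eq orthogonal_def)
  show "\<exists>H :: real^'n^'n. hadamard_matrix H"
  proof (rule hadamard_of_orthogonal_signs)
    have "?one \<noteq> 0" by (simp add: vec_eq_iff)
    then have "?one \<notin> S" using oneS orthogonal_self by blast
    moreover have "finite S"
      using card_orthogonal_le(1)[OF S(2)] sgn zero_not_sign_vector by blast
    ultimately show "card (insert ?one S) = CARD('n)" using S(3) by simp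
    show "insert ?one S \<subseteq> sign_vectors" using sgn by (auto simp: sign_vectors_def)
    show "pairwise orthogonal (insert ?one S)"
      using S(2) oneS by (auto simp: pairwise_insert orthogonal_commute)
  qed
qed

section \<open>Maximum cuts from a Hadamard matrix\<close>

lemma weight_matrix_complete: "0 \<le> c \<Longrightarrow> weight_matrix (c *\<^sub>R adj_complete)"
  by (auto simp: weight_matrix_def adj_complete_def transpose_def vec_eq_iff)

text \<open>
  On sign vectors the quadratic form of \<open>A(K\<^sub>n)\<close> is \<open>(\<Sum>i. x\<^sub>i)\<^sup>2 - n\<close>, and the cut
  value decreases with this form, so it is largest when the entries sum to zero.
\<close>

lemma balanced_max_cut_complete:
  fixes x :: "real^'n"
  assumes c: "0 \<le> c" and x: "x \<in> sign_vectors" and bal: "(\<Sum>i\<in>UNIV. x $ i) = 0"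
  shows "x \<in> max_cuts (c *\<^sub>R adj_complete)"
proof -
  let ?W = "c *\<^sub>R adj_complete :: real^'n^'n"
  have quad: "y \<bullet> (?W *v y) = c * ((\<Sum>i\<in>UNIV. y $ i)\<^sup>2 - CARD('n))"
    if "y \<in> sign_vectors" for y :: "real^'n"
  proof -
    have "?W $ i $ j * (y $ i * y $ j)
        = c * (y $ i * y $ j) - (if j = i then c * (y $ i * y $ i) else 0)" for i j
      by (simp add: adj_complete_def)
    then have "y \<bullet> (?W *v y) =
        (\<Sum>i\<in>UNIV. (\<Sum>j\<in>UNIV. c * (y $ i * y $ j)) - c * (y $ i * y $ i))"
      unfolding inner_matrix_vector by (simp only: sum_subtractf sum.delta) simp
    moreover have "(\<Sum>i\<in>UNIV. y $ i)\<^sup>2 = (\<Sum>i\<in>UNIV. \<Sum>j\<in>UNIV. y $ i * y $ j)"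
      by (simp only: power2_eq_square sum_product)
    ultimately have "y \<bullet> (?W *v y) = c * ((\<Sum>i\<in>UNIV. y $ i)\<^sup>2 - y \<bullet> y)"
      by (simp only: sum_subtractf inner_vec_def inner_real_def right_diff_distrib sum_distrib_left)
    then show ?thesis by (simp add: inner_sign_vector_self[OF that])
  qed
  have "cut_value ?W y \<le> cut_value ?W x" if "y \<in> sign_vectors" for y
    using c bal by (simp add: cut_value_eq weight_matrix_complete quad x that algebra_simps)
  then have "MC ?W = cut_value ?W x"
    unfolding MC_def using x finite_sign_vectors by (intro Max_eqI) auto
  then show ?thesis using x by (simp add: max_cuts_def)
qed

lemma orthogonal_max_cuts_of_hadamard:
  fixes H :: "real^'n^'n"
  assumes H: "hadamard_matrix H" and c: "0 \<le> c"
  shows "\<exists>S. S \<subseteq> max_cuts (c *\<^sub>R adj_complete :: real^'n^'n) \<and> pairwise orthogonal S \<and>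
    card S = CARD('n) - 1"
proof -
  define k :: 'n where "k = undefined"
  \<comment> \<open>column signs chosen so that row \<open>k\<close> becomes the all-ones vector\<close>
  define h where "h i = (\<chi> j. H $ i $ j * H $ k $ j)" for i
  have Hs: "H $ i $ j \<in> {-1, 1}" for i j using H by (simp add: hadamard_matrix_def)
  have HH: "(\<Sum>j\<in>UNIV. H $ i $ j * H $ l $ j) = (if i = l then real CARD('n) else 0)" for i l
  proof -
    have "(H ** transpose H) $ i $ l = mat (real CARD('n)) $ i $ l"
      using H by (simp add: hadamard_matrix_def)
    then show ?thesis by (simp add: matrix_matrix_mult_def transpose_def mat_def)
  qed
  have hs: "h i \<in> sign_vectors" for i
  proof -
    have "h i $ j \<in> {-1, 1}" for j using Hs[of i j] Hs[of k j] by (auto simp: h_def)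
    then show ?thesis by (simp add: sign_vectors_def)
  qed
  have inner: "h i \<bullet> h l = (if i = l then real CARD('n) else 0)" for i l
  proof -
    have "h i $ j * h l $ j = H $ i $ j * H $ l $ j" for j
      using Hs[of k j] by (auto simp: h_def)
    then show ?thesis using HH[of i l] by (simp add: inner_vec_def)
  qed
  have "h i \<noteq> h l" if "i \<noteq> l" for i l
    using inner[of i i] inner[of i l] that by auto
  then have "inj h" by (auto simp: inj_def)
  let ?S = "h ` (UNIV - {k})"
  have "h i \<in> max_cuts (c *\<^sub>R adj_complete)" if "i \<noteq> k" for i
    using HH[of i k] that by (intro balanced_max_cut_complete c hs) (simp add: h_def)
  then have "?S \<subseteq> max_cuts (c *\<^sub>R adj_complete)" by blast
  moreover have "pairwise orthogonal ?S"
    using inner by (auto simp: pairwise_def orthogonal_def)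
  moreover have "card ?S = CARD('n) - 1"
    using \<open>inj h\<close> by (simp add: card_image inj_on_def)
  ultimately show ?thesis by blast
qed

lemma card_le_orthogonality_number:
  fixes W :: "real^'n^'n"
  assumes "S \<subseteq> max_cuts W" "pairwise orthogonal S"
  shows "card S \<le> orthogonality_number W"
proof -
  have "finite (max_cuts W)"
    unfolding max_cuts_def by (rule finite_subset[OF _ finite_sign_vectors]) blast
  then have "finite (card ` Pow (max_cuts W))" by simp
  then have "finite {card S |S. S \<subseteq> max_cuts W \<and> pairwise orthogonal S}"
    by (rule rev_finite_subset) blast
  then show ?thesis
    unfolding orthogonality_number_def using assms by (intro Max_ge) blast+
qed

theorem theorem6p1:
  fixes W :: "real^'n^'n"
  assumes "CARD('n) \<ge> 2"
    and "weight_matrix W"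
    and "exact_instance W"
    and "\<forall>i. \<not> isolated_vertex W i"
  shows "orthogonality_number W \<le> CARD('n) - 1 \<and>
    (orthogonality_number W = CARD('n) - 1 \<longleftrightarrow>
       (\<exists>H :: real^'n^'n. hadamard_matrix H) \<and>
       (\<exists>c > 0. W = c *\<^sub>R adj_complete))"
proof (intro conjI)
  obtain S where S: "S \<subseteq> max_cuts W" "pairwise orthogonal S" "card S = orthogonality_number W"
    using orthogonality_number_attained by blast
  show le: "orthogonality_number W \<le> CARD('n) - 1"
    using card_orthogonal_max_cuts_less[OF assms(2-4) S(1,2)] S(3) by simp
  show "orthogonality_number W = CARD('n) - 1 \<longleftrightarrow>
       (\<exists>H :: real^'n^'n. hadamard_matrix H) \<and> (\<exists>c > 0. W = c *\<^sub>R adj_complete)"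
  proof
    assume "orthogonality_number W = CARD('n) - 1"
    then show "(\<exists>H :: real^'n^'n. hadamard_matrix H) \<and> (\<exists>c > 0. W = c *\<^sub>R adj_complete)"
      using extremal_orthogonal_max_cuts[OF assms(2-4) S(1,2)] S(3) by simp
  next
    assume "(\<exists>H :: real^'n^'n. hadamard_matrix H) \<and> (\<exists>c > 0. W = c *\<^sub>R adj_complete)"
    then obtain H :: "real^'n^'n" and c where "hadamard_matrix H" "c > 0" "W = c *\<^sub>R adj_complete"
      by blast
    then obtain T where "T \<subseteq> max_cuts W" "pairwise orthogonal T" "card T = CARD('n) - 1"
      using orthogonal_max_cuts_of_hadamard[of H c] by auto
    then show "orthogonality_number W = CARD('n) - 1"
      using card_le_orthogonality_number[of T W] le by simp
  qed
qed

end
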